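(* Let $a,b$ be positive integers with $b>2a$. Then for all sufficiently large $n$ (depending on $a,b$), in the $(a:b)$ mindegree-$1$ Maker-PhantomBreaker game on $E(K_n)$, PhantomBreaker has a randomized strategy such that, whatever (possibly randomized) strategy Maker uses, the probability that Maker wins is at most $$\prod_{i=0}^{\left\lfloor\frac{b}{2a}\right\rfloor -1} \frac{1}{\frac{b}{2a}-i}.$$
   Context: Maker-PhantomBreaker game. The board is the edge set $E(K_n)$ of the complete graph on $n$ vertices, and there is a family of winning sets (edge sets of certain subgraphs of $K_n$). Initially all edges are unclaimed. Two players, Maker and PhantomBreaker, alternate turns, Maker going first. In an $(a:b)$ game, in each round Maker first makes $a$ moves, one after another, each consisting of attempting to claim one edge of $K_n$; then PhantomBreaker claims $b$ unclaimed edges (all remaining unclaimed edges if fewer than $b$ remain). If the edge Maker attempts to claim is unclaimed, it becomes hers. If it has already been claimed by PhantomBreaker, then that move of Maker is lost (she gets no replacement move) and she learns that this edge belongs to PhantomBreaker. Information: PhantomBreaker has complete information about the game so far (he sees all previous moves of Maker, including failed attempts, but not the outcomes of Maker's future random choices). Maker sees none of PhantomBreaker's moves; her only information about them is the success or failure of her own previous attempts. Maker wins if at some point she has claimed all edges of some winning set; otherwise PhantomBreaker wins. Both players may use randomized strategies, where each decision of PhantomBreaker may depend only on all previous moves of both players (including Maker's failed attempts) and his own randomness, and each decision of Maker may depend only on her own previous attempts, their success or failure, and her own randomness. Mindegree-$k$ game: the winning sets are the edge sets of all spanning subgraphs of $K_n$ with minimum degree $k$ (equivalently, Maker wins iff every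 vertex eventually has degree at least $k$ in the graph of Maker's claimed edges). The mindegree-$1$ game is the case $k=1$. *)

theory Defs
  imports "HOL-Probability.Probability"
begin

text \<open>
  A history is the list of all moves made so far, with the most recent move first.
  A failed attempt of Maker is recorded in the same way as a successful one; whether it
  succeeded is determined by the part of the history that precedes it.
\<close>

datatype 'e move = Attempt 'e | Claim "'e set"

type_synonym 'e history = "'e move list"

fun breaker_edges :: "'e history \<Rightarrow> 'e set" where
  "breaker_edges [] = {}"
| "breaker_edges (Attempt e # h) = breaker_edges h"
| "breaker_edges (Claim S # h) = S \<union> breaker_edges h"

text \<open>
  Attempting an edge that Maker already owns is allowed and changes nothing.
\<close>

fun maker_edges :: "'e history \<Rightarrow> 'e set" where
  "maker_edges [] = {}"
| "maker_edges (Attempt e # h) =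
     (if e \<in> breaker_edges h then maker_edges h else insert e (maker_edges h))"
| "maker_edges (Claim S # h) = maker_edges h"

text \<open>
  The information available to Maker: her own attempts, each with a flag telling whether it
  succeeded, again with the most recent one first.
\<close>

fun maker_view :: "'e history \<Rightarrow> ('e \<times> bool) list" where
  "maker_view [] = []"
| "maker_view (Attempt e # h) = (e, e \<notin> breaker_edges h) # maker_view h"
| "maker_view (Claim S # h) = maker_view h"

definition unclaimed :: "'e set \<Rightarrow> 'e history \<Rightarrow> 'e set" where
  "unclaimed X h = X - (maker_edges h \<union> breaker_edges h)"

type_synonym 'e maker = "('e \<times> bool) list \<Rightarrow> 'e"
type_synonym 'e breaker = "'e history \<Rightarrow> 'e set"

definition maker_strategy :: "'e set \<Rightarrow> 'e maker \<Rightarrow> bool" where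
  "maker_strategy X m \<longleftrightarrow> (\<forall>v. m v \<in> X)"

definition breaker_strategy :: "'e set \<Rightarrow> nat \<Rightarrow> 'e breaker \<Rightarrow> bool" where
  "breaker_strategy X b p \<longleftrightarrow>
     (\<forall>h. p h \<subseteq> unclaimed X h \<and> card (p h) = min b (card (unclaimed X h)))"

definition maker_step :: "'e maker \<Rightarrow> 'e history \<Rightarrow> 'e history" where
  "maker_step m h = Attempt (m (maker_view h)) # h"

definition breaker_step :: "'e breaker \<Rightarrow> 'e history \<Rightarrow> 'e history" where
  "breaker_step p h = Claim (p h) # h"

text \<open>
  The history after \<open>r\<close> full rounds. Once the board is exhausted, further rounds
  change neither player's set of edges, so the game need not be stopped explicitly.
\<close>

definition play :: "nat \<Rightarrow> 'e maker \<Rightarrow> 'e breaker \<Rightarrow> nat \<Rightarrow> 'e history" where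
  "play a m p r = ((\<lambda>h. breaker_step p ((maker_step m ^^ a) h)) ^^ r) []"

text \<open>
  Maker never loses edges, so it suffices to look at the ends of rounds.
\<close>

definition maker_wins :: "'e set set \<Rightarrow> nat \<Rightarrow> 'e maker \<Rightarrow> 'e breaker \<Rightarrow> bool" where
  "maker_wins F a m p \<longleftrightarrow> (\<exists>r. \<exists>W\<in>F. W \<subseteq> maker_edges (play a m p r))"

text \<open>
  A randomized strategy is a distribution over deterministic ones: the player's own
  randomness is drawn at the outset, independently of the opponent's. Discrete distributions
  lose no generality on a finite board with \<open>b > 0\<close>: all edges are claimed after finitely
  many rounds, and until then only finitely many histories can arise.
\<close>

definition randomized_maker :: "'e set \<Rightarrow> 'e maker pmf \<Rightarrow> bool" where
  "randomized_maker X M \<longleftrightarrow> (\<forall>m\<in>set_pmf M. maker_strategy X m)"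

definition randomized_breaker :: "'e set \<Rightarrow> nat \<Rightarrow> 'e breaker pmf \<Rightarrow> bool" where
  "randomized_breaker X b P \<longleftrightarrow> (\<forall>p\<in>set_pmf P. breaker_strategy X b p)"

definition maker_win_prob :: "'e set set \<Rightarrow> nat \<Rightarrow> 'e maker pmf \<Rightarrow> 'e breaker pmf \<Rightarrow> real" where
  "maker_win_prob F a M P =
     measure_pmf.prob (pair_pmf M P) {(m, p). maker_wins F a m p}"

definition complete_edges :: "nat \<Rightarrow> nat set set" where
  "complete_edges n = {e. e \<subseteq> {..<n} \<and> card e = 2}"

definition degree_in :: "nat set set \<Rightarrow> nat \<Rightarrow> nat" where
  "degree_in E v = card {e \<in> E. v \<in> e}"

definition min_degree :: "nat \<Rightarrow> nat set set \<Rightarrow> nat" where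
  "min_degree n E = Min (degree_in E ` {..<n})"

text \<open>
  Deleting one edge lowers the minimum degree by at most one, so an edge set contains a member
  of this family iff its minimum degree is at least \<open>k\<close> (for \<open>n > 0\<close>).
\<close>

definition mindegree_sets :: "nat \<Rightarrow> nat \<Rightarrow> nat set set set" where
  "mindegree_sets n k = {E. E \<subseteq> complete_edges n \<and> min_degree n E = k}"

end

theory Submission imports Defs begin

text \<open>
  PhantomBreaker orders the vertices uniformly at random and always claims edges at his
  \<^emph>\<open>target\<close>, the first vertex of the order that is not yet \<^emph>\<open>touched\<close>, that is, not an endpoint of
  any edge that Maker has attempted so far. If one target survives long enough, he owns its whole
  star and Maker has lost.

  The point is that Maker learns nothing about the current target before she touches it. While she
  does not touch it and its star is incomplete, PhantomBreaker only gains edges at the target, so the answers she gets are the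
  ones she would get if he had stopped claiming when he chose that target. Her attempts
  until she touches it thus form a sequence that does not depend on which
  untouched vertex it is (\<open>ghost_attempt\<close>, \<open>chase_ends\<close>). A target falls only if it is an
  endpoint of one of the first \<open>T\<close> attempts of this sequence, where \<open>T\<close> is about \<open>a n / b\<close>, and
  when it falls, the order of the vertices that are still untouched is again uniform.

  So let \<open>u\<close> vertices be untouched. If the target falls at attempt \<open>i\<close> of the sequence (counted from
  1), at least \<open>u - 2 i\<close> vertices are untouched afterwards, and each \<open>i\<close> accounts for at most two of
  the \<open>u\<close> equally likely targets. Upper bounds \<open>f\<close> for the probability that Maker covers all vertices
  therefore obey \<open>f u = (2 / u) * (f (u - 2) + f (u - 4) + ... + f (u - 2 T))\<close>
  (\<open>cover_bound_step\<close>). Replacing every summand by the last one, which is the largest, and iterating gives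
  \<open>f u = D / u * (D / (u - D)) * (D / (u - 2 D)) * ...\<close> with \<open>D = 2 T\<close> (\<open>bound_restart_prod\<close>).
  For \<open>u = n\<close>, the quotient \<open>n / D\<close> tends to \<open>c = b / (2 a)\<close>, so the product of the first
  \<open>\<lfloor>c\<rfloor>\<close> factors tends to \<open>1 / (c (c - 1) (c - 2) ...)\<close>, which is the claimed bound.

  Since \<open>D\<close> exceeds \<open>n / c\<close> by a rounding error, this alone gives the bound only in the limit. The
  slack comes from the summands with small \<open>i\<close>: if the target falls early, many more than
  \<open>u - D\<close> vertices are untouched when the next one is chosen. Estimating a small constant
  fraction of the summands separately lowers the limit by a positive constant
  (\<open>bound_two_speeds\<close>, \<open>early_touches_gain\<close>), and the rounding errors vanish for large \<open>n\<close>.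
\<close>

section \<open>The game as a sequence of single moves\<close>

fun touched :: "'v set history \<Rightarrow> 'v set" where
  "touched [] = {}"
| "touched (Attempt e # h) = e \<union> touched h"
| "touched (Claim S # h) = touched h"

fun attempts_in_round :: "'e history \<Rightarrow> nat" where
  "attempts_in_round [] = 0"
| "attempts_in_round (Attempt e # h) = Suc (attempts_in_round h)"
| "attempts_in_round (Claim S # h) = 0"

text \<open>
  Chases begin and end in the middle of rounds, so the game is run one move at a time. Whose turn it
  is can be read off the history; a round is complete exactly when the last move is a claim.
\<close>

definition next_move :: "nat \<Rightarrow> 'e maker \<Rightarrow> 'e breaker \<Rightarrow> 'e history \<Rightarrow> 'e history" where
  "next_move a m p h = (if attempts_in_round h < a then maker_step m h else breaker_step p h)"

definition star :: "'v set set \<Rightarrow> 'v \<Rightarrow> 'v set set" where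
  "star X v = {e \<in> X. v \<in> e}"

definition covers :: "'v set \<Rightarrow> 'v set history \<Rightarrow> bool" where
  "covers V h \<longleftrightarrow> (\<forall>v\<in>V. \<exists>e\<in>maker_edges h. v \<in> e)"

text \<open>
  The arguments below restart the game from intermediate histories, so winning is a property of the
  history from which play goes on.
\<close>

definition covers_from :: "'v set \<Rightarrow> nat \<Rightarrow> 'v set maker \<Rightarrow> 'v set breaker \<Rightarrow> 'v set history \<Rightarrow> bool" where
  "covers_from V a m p h \<longleftrightarrow> (\<exists>k. covers V ((next_move a m p ^^ k) h))"

lemma next_move_cases:
  obtains e where "next_move a m p h = Attempt e # h" "e = m (maker_view h)" "attempts_in_round h < a"
  | "next_move a m p h = Claim (p h) # h" "\<not> attempts_in_round h < a"
  unfolding next_move_def maker_step_def breaker_step_def by metis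

lemma maker_steps_are_next_moves:
  assumes "attempts_in_round h = 0" "j \<le> a"
  shows "(next_move a m p ^^ j) h = (maker_step m ^^ j) h
    \<and> attempts_in_round ((maker_step m ^^ j) h) = j"
  using assms(2)
  by (induction j) (use assms(1) in \<open>auto simp: next_move_def maker_step_def\<close>)

lemma play_eq_next_moves:
  "play a m p r = (next_move a m p ^^ (Suc a * r)) [] \<and> attempts_in_round (play a m p r) = 0"
proof (induction r)
  case (Suc r)
  let ?h = "play a m p r"
  note steps = maker_steps_are_next_moves[OF conjunct2[OF Suc.IH] order_refl, where m = m and p = p]
  have "(next_move a m p ^^ (Suc a * Suc r)) [] = (next_move a m p ^^ Suc a) ((next_move a m p ^^ (Suc a * r)) [])"
    by (simp only: mult_Suc_right funpow_add o_def)
  also have "\<dots> = (next_move a m p ^^ Suc a) ?h"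
    by (simp only: conjunct1[OF Suc.IH])
  also have "\<dots> = next_move a m p ((maker_step m ^^ a) ?h)"
    by (simp only: funpow.simps o_def conjunct1[OF steps])
  also have "\<dots> = breaker_step p ((maker_step m ^^ a) ?h)"
    by (simp only: next_move_def conjunct2[OF steps] less_irrefl if_False)
  also have "\<dots> = play a m p (Suc r)"
    by (simp add: play_def)
  finally show ?case
    by (simp add: play_def breaker_step_def)
qed (simp add: play_def)

lemma maker_edges_mono: "maker_edges h \<subseteq> maker_edges (next_move a m p h)"
  by (rule next_move_cases[of a m p h]) auto

lemma touched_mono: "touched h \<subseteq> touched (next_move a m p h)"
  by (rule next_move_cases[of a m p h]) auto

lemma touched_funpow_mono: "j \<le> k \<Longrightarrow> touched ((next_move a m p ^^ j) h) \<subseteq> touched ((next_move a m p ^^ k) h)"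
  by (rule lift_Suc_mono_le[of "\<lambda>k. touched ((next_move a m p ^^ k) h)"]) (auto dest: touched_mono[THEN subsetD])

lemma covers_mono: "covers V h \<Longrightarrow> covers V (next_move a m p h)"
  using maker_edges_mono[of h a m p] unfolding covers_def by blast

lemma covers_from_later:
  assumes "covers_from V a m p h"
  shows "covers_from V a m p ((next_move a m p ^^ j) h)"
proof -
  obtain k where "covers V ((next_move a m p ^^ k) h)"
    using assms unfolding covers_from_def by blast
  then have "covers V ((next_move a m p ^^ (k + j)) h)"
    by (induction j) (auto simp: covers_mono)
  then show ?thesis
    unfolding covers_from_def by (metis comp_apply funpow_add)
qed

lemma maker_edge_touched: "e \<in> maker_edges h \<Longrightarrow> e \<subseteq> touched h"
  by (induction h rule: maker_edges.induct) (auto split: if_splits)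

lemma isolated_never_covered:
  assumes attempts: "\<And>w. m w \<in> X" and "v \<in> V" and star: "star X v \<subseteq> breaker_edges h" and "v \<notin> touched h"
  shows "\<not> covers_from V a m p h"
proof -
  let ?run = "\<lambda>k. (next_move a m p ^^ k) h"
  have "star X v \<subseteq> breaker_edges (?run k) \<and> (\<forall>e\<in>maker_edges (?run k). v \<notin> e)" for k
  proof (induction k)
    case 0
    show ?case using star \<open>v \<notin> touched h\<close> maker_edge_touched by fastforce
  next
    case (Suc k)
    show ?case
    proof (rule next_move_cases[of a m p "?run k"])
      fix e assume "next_move a m p (?run k) = Attempt e # ?run k" "e = m (maker_view (?run k))"
      then show ?thesis using Suc attempts by (auto simp: star_def)
    qed (use Suc in auto)
  qed
  then show ?thesis
    using \<open>v \<in> V\<close> unfolding covers_from_def covers_def by blast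
qed

section \<open>Chasing one vertex\<close>

text \<open>
  The rules force exactly \<open>b\<close> claims while enough edges are free, so a set inside the star is not
  always available. Claims outside the star occur only when they come on top of
  all edges of the star that are still free.
\<close>

definition star_claim :: "'v set set \<Rightarrow> nat \<Rightarrow> 'v \<Rightarrow> 'v set breaker" where
  "star_claim X b v h = (SOME S. S \<subseteq> unclaimed X h \<and> card S = min b (card (unclaimed X h))
     \<and> (S \<subseteq> star X v \<or> star X v \<inter> unclaimed X h \<subseteq> S))"

lemma star_claim:
  assumes "finite X"
  shows "star_claim X b v h \<subseteq> unclaimed X h"
    "card (star_claim X b v h) = min b (card (unclaimed X h))"
    "star_claim X b v h \<subseteq> star X v \<or> star X v \<inter> unclaimed X h \<subseteq> star_claim X b v h"
proof -
  let ?U = "unclaimed X h" and ?A = "star X v \<inter> unclaimed X h"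
  have fin: "finite ?U" using assms by (simp add: unclaimed_def)
  have le: "card ?A \<le> card ?U" using fin by (simp add: card_mono)
  have "\<exists>S. S \<subseteq> ?U \<and> card S = min b (card ?U) \<and> (S \<subseteq> star X v \<or> ?A \<subseteq> S)"
  proof (cases "b \<le> card ?A")
    case True
    then obtain S where "S \<subseteq> ?A" "card S = b" by (meson obtain_subset_with_card_n)
    then show ?thesis using True le by (intro exI[of _ S]) auto
  next
    case False
    then show ?thesis
      using exists_subset_between[of ?A "min b (card ?U)" ?U] fin le by auto
  qed
  from someI_ex[OF this] show "star_claim X b v h \<subseteq> unclaimed X h"
    "card (star_claim X b v h) = min b (card (unclaimed X h))"
    "star_claim X b v h \<subseteq> star X v \<or> star X v \<inter> unclaimed X h \<subseteq> star_claim X b v h"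
    unfolding star_claim_def by blast+
qed

text \<open>
  None of the edges at an untouched vertex is Maker's. Hence a claim that is not \<open>b\<close> new edges
  of its star finishes the star.
\<close>

lemma star_claim_cases:
  assumes "finite X" and "v \<notin> touched h"
  obtains (complete) "star X v \<subseteq> breaker_edges (Claim (star_claim X b v h) # h)"
  | (grow) "star_claim X b v h \<subseteq> star X v" "star_claim X b v h \<inter> breaker_edges h = {}"
      "card (star_claim X b v h) = b"
proof -
  let ?S = "star_claim X b v h" and ?U = "unclaimed X h"
  have fin: "finite ?U" using assms by (simp add: unclaimed_def)
  have unclaimed: "star X v \<subseteq> ?U \<union> breaker_edges h"
    using maker_edge_touched assms(2) by (fastforce simp: star_def unclaimed_def)
  show ?thesis
  proof (cases "star X v \<inter> ?U \<subseteq> ?S")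
    case True
    then show ?thesis using unclaimed by (intro complete) auto
  next
    case False
    then have sub: "?S \<subseteq> star X v" using star_claim(3)[OF assms(1)] by blast
    have "card ?S = b"
    proof (rule ccontr)
      assume "card ?S \<noteq> b"
      then have "card ?S = card ?U" using star_claim(2)[OF assms(1), of b v h] by linarith
      then have "?S = ?U" using star_claim(1)[OF assms(1)] fin by (simp add: card_subset_eq)
      with False show False by blast
    qed
    moreover have "?S \<inter> breaker_edges h = {}"
      using star_claim(1)[OF assms(1), of b v h] by (auto simp: unclaimed_def)
    ultimately show ?thesis using sub grow by blast
  qed
qed

text \<open>
  What Maker sees in the following attempts if the set \<open>B\<close> of PhantomBreaker's edges stays as it is.
\<close>

primrec ghost_view :: "'e maker \<Rightarrow> 'e set \<Rightarrow> ('e \<times> bool) list \<Rightarrow> nat \<Rightarrow> ('e \<times> bool) list" where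
  "ghost_view m B w 0 = w"
| "ghost_view m B w (Suc i) = (m (ghost_view m B w i), m (ghost_view m B w i) \<notin> B) # ghost_view m B w i"

definition ghost_attempt :: "'e maker \<Rightarrow> 'e history \<Rightarrow> nat \<Rightarrow> 'e" where
  "ghost_attempt m h i = m (ghost_view m (breaker_edges h) (maker_view h) i)"

text \<open>
  The state \<open>h'\<close> of a chase of \<open>v\<close> that began in \<open>h\<close>, after \<open>i\<close> attempts and \<open>c\<close> claims, with \<open>v\<close>
  still untouched and every claim so far worth \<open>b\<close> edges at \<open>v\<close>. The last conjunct bounds the attempts
  by the claims: an unfinished round contributes at most \<open>a\<close> of them.
\<close>

definition chasing :: "'v set set \<Rightarrow> nat \<Rightarrow> nat \<Rightarrow> 'v set maker \<Rightarrow> 'v set history \<Rightarrow> 'v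
    \<Rightarrow> 'v set history \<Rightarrow> nat \<Rightarrow> nat \<Rightarrow> bool" where
  "chasing X a b m h v h' i c \<longleftrightarrow>
     v \<notin> touched h'
     \<and> maker_view h' = ghost_view m (breaker_edges h) (maker_view h) i
     \<and> touched h' = touched h \<union> (\<Union>j<i. ghost_attempt m h j)
     \<and> breaker_edges h \<subseteq> breaker_edges h'
     \<and> breaker_edges h' \<subseteq> breaker_edges h \<union> star X v
     \<and> b * c \<le> card (star X v \<inter> breaker_edges h')
     \<and> i \<le> a * c + min a (attempts_in_round h')"

lemma chasing_touched:
  assumes "chasing X a b m h v h' i c"
  shows "v \<notin> touched h'" "touched h' = touched h \<union> (\<Union>j<i. ghost_attempt m h j)"
  using assms unfolding chasing_def by blast+

lemma chasing_start: "v \<notin> touched h \<Longrightarrow> chasing X a b m h v h 0 0"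
  by (simp add: chasing_def)

text \<open>
  Maker's view stays the ghost view because PhantomBreaker's new edges all contain \<open>v\<close>: an attempt
  that misses \<open>v\<close> succeeds if and only if it would have succeeded without them.
\<close>

lemma chasing_step:
  assumes "finite X" and chase: "chasing X a b m h v h' i c"
  defines "h'' \<equiv> next_move a m (star_claim X b v) h'"
  obtains (hit) "v \<in> ghost_attempt m h i" "h'' = Attempt (ghost_attempt m h i) # h'" "i < a * Suc c"
  | (miss) "chasing X a b m h v h'' (Suc i) c"
  | (grow) "chasing X a b m h v h'' i (Suc c)"
  | (complete) "v \<notin> touched h''" "star X v \<subseteq> breaker_edges h''"
proof (rule next_move_cases[of a m "star_claim X b v" h'])
  fix e assume e: "next_move a m (star_claim X b v) h' = Attempt e # h'" "e = m (maker_view h')"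
    and early: "attempts_in_round h' < a"
  have ghost: "e = ghost_attempt m h i"
    using chase e(2) by (simp add: chasing_def ghost_attempt_def)
  have i: "i \<le> a * c + attempts_in_round h'"
    using chase early by (simp add: chasing_def)
  show ?thesis
  proof (cases "v \<in> e")
    case True
    with hit e(1) ghost i early show ?thesis by (simp add: h''_def)
  next
    case False
    then have "e \<in> breaker_edges h' \<longleftrightarrow> e \<in> breaker_edges h"
      using chase by (auto simp: chasing_def star_def)
    then have "chasing X a b m h v (Attempt e # h') (Suc i) c"
      using chase False ghost i early
      by (auto simp: chasing_def ghost_attempt_def lessThan_Suc)
    with miss e(1) show ?thesis by (simp add: h''_def)
  qed
next
  assume claim: "next_move a m (star_claim X b v) h' = Claim (star_claim X b v h') # h'"
    and late: "\<not> attempts_in_round h' < a"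
  let ?S = "star_claim X b v h'"
  have untouched: "v \<notin> touched h'" using chase by (rule chasing_touched)
  from \<open>finite X\<close> untouched show ?thesis
  proof (cases rule: star_claim_cases[where b = b])
    case complete
    then show ?thesis using that(4) claim untouched by (simp add: h''_def)
  next
    case grow
    have fin: "finite (star X v)" using \<open>finite X\<close> by (simp add: star_def)
    have "card (star X v \<inter> (?S \<union> breaker_edges h')) = card (?S \<union> (star X v \<inter> breaker_edges h'))"
      using grow(1) by (intro arg_cong[where f = card]) auto
    also have "\<dots> = b + card (star X v \<inter> breaker_edges h')"
      using grow fin by (subst card_Un_disjoint) (auto intro: finite_subset)
    finally have "chasing X a b m h v (Claim ?S # h') i (Suc c)"
      using chase grow(1) late by (auto simp: chasing_def)
    then show ?thesis using that(3) claim by (simp add: h''_def)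
  qed
qed

text \<open>
  Each claim costs \<open>b\<close> edges of the star and at most \<open>a\<close> attempts separate consecutive claims, so a
  chase cannot go on forever. It ends with \<open>v\<close> isolated, or with an attempt that touches \<open>v\<close> and comes
  early in the ghost sequence.
\<close>

lemma chase_ends:
  fixes a :: nat and m :: "'v set maker"
  assumes "finite X" "0 < b" "v \<notin> touched h"
  defines "run \<equiv> \<lambda>k. (next_move a m (star_claim X b v) ^^ k) h"
  obtains (isolated) k where "v \<notin> touched (run k)" "star X v \<subseteq> breaker_edges (run k)"
  | (hit) k i where "v \<notin> touched (run k)" "v \<in> ghost_attempt m h i"
      "run (Suc k) = Attempt (ghost_attempt m h i) # run k"
      "touched (run k) = touched h \<union> (\<Union>j<i. ghost_attempt m h j)"
      "i < a * Suc (card (star X v) div b)"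
proof -
  have bounded: "c \<le> card (star X v) div b" if "chasing X a b m h v h' i c" for h' i c
  proof -
    have "b * c \<le> card (star X v \<inter> breaker_edges h')" using that by (simp add: chasing_def)
    also have "\<dots> \<le> card (star X v)" using assms(1) by (intro card_mono) (auto simp: star_def)
    finally show ?thesis using \<open>0 < b\<close> by (simp add: less_eq_div_iff_mult_less_eq mult.commute)
  qed
  let ?hit = "\<lambda>k i c. chasing X a b m h v (run k) i c \<and> v \<in> ghost_attempt m h i
     \<and> run (Suc k) = Attempt (ghost_attempt m h i) # run k \<and> i < a * Suc c"
  let ?end = "\<exists>k. v \<notin> touched (run k) \<and> (star X v \<subseteq> breaker_edges (run k)) \<or> (\<exists>i c. ?hit k i c)"
  \<comment> \<open>Every move is an attempt or a claim, so after \<open>k\<close> moves of an unfinished chase \<open>i + c = k\<close>.\<close>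
  have "?end \<or> (\<exists>i c. i + c = k \<and> chasing X a b m h v (run k) i c)" for k
  proof (induction k)
    case 0
    then show ?case using chasing_start[OF assms(3)] by (auto simp: run_def)
  next
    case (Suc k)
    show ?case
    proof (cases ?end)
      case False
      then obtain i c where ic: "i + c = k" and chase: "chasing X a b m h v (run k) i c"
        using Suc by blast
      have step: "run (Suc k) = next_move a m (star_claim X b v) (run k)" by (simp add: run_def)
      from \<open>finite X\<close> chase show ?thesis
      proof (cases rule: chasing_step)
        case hit
        then show ?thesis using chase step by metis
      next
        case miss
        then show ?thesis using ic step by (metis add_Suc)
      next
        case grow
        then show ?thesis using ic step by (metis add_Suc_right)
      next
        case complete
        then show ?thesis using step by metis
      qed
    qed blast
  qed
  moreover have "i + c \<le> a * (card (star X v) div b) + a + card (star X v) div b"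
    if "chasing X a b m h v h' i c" for h' i c
  proof -
    have "i \<le> a * c + a" using that by (auto simp: chasing_def)
    moreover have "a * c \<le> a * (card (star X v) div b)" using bounded[OF that] by simp
    ultimately show ?thesis using bounded[OF that] by linarith
  qed
  ultimately have ?end
    by (metis not_less_eq_eq)
  then show ?thesis
  proof
    fix k assume "v \<notin> touched (run k) \<and> (star X v \<subseteq> breaker_edges (run k)) \<or> (\<exists>i c. ?hit k i c)"
    then show ?thesis
    proof (elim disjE exE conjE)
      fix i c assume *: "chasing X a b m h v (run k) i c" "v \<in> ghost_attempt m h i"
        "run (Suc k) = Attempt (ghost_attempt m h i) # run k" "i < a * Suc c"
      have "a * Suc c \<le> a * Suc (card (star X v) div b)"
        using bounded[OF *(1)] by (intro mult_le_mono) auto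
      then have "i < a * Suc (card (star X v) div b)" using *(4) by linarith
      with * hit[of k i] show ?thesis using chasing_touched[OF *(1)] by blast
    qed (use isolated in blast)
  qed
qed

section \<open>Chasing vertices in random order\<close>

text \<open>
  The target is a function of the order and of the touched set alone. It stays the same until it is
  touched, without having to be remembered. When all vertices are touched, the head of the empty list
  is an arbitrary vertex.
\<close>

definition target :: "'v list \<Rightarrow> 'v set history \<Rightarrow> 'v" where
  "target \<sigma> h = hd (filter (\<lambda>v. v \<notin> touched h) \<sigma>)"

definition star_breaker :: "'v set set \<Rightarrow> nat \<Rightarrow> 'v list \<Rightarrow> 'v set breaker" where
  "star_breaker X b \<sigma> h = star_claim X b (target \<sigma> h) h"

lemma star_breaker_strategy: "finite X \<Longrightarrow> breaker_strategy X b (star_breaker X b \<sigma>)"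
  by (simp add: breaker_strategy_def star_breaker_def star_claim)

lemma funpow_cong_invariant:
  assumes "\<And>i. i < k \<Longrightarrow> f ((g ^^ i) x) = g ((g ^^ i) x)"
  shows "(f ^^ k) x = (g ^^ k) x"
  using assms by (induction k) auto

lemma head_is_chased:
  assumes "v \<notin> touched ((next_move a m (star_claim X b v) ^^ k) h)" and "j \<le> Suc k"
  shows "(next_move a m (star_breaker X b (v # \<sigma>)) ^^ j) h = (next_move a m (star_claim X b v) ^^ j) h"
proof (rule funpow_cong_invariant)
  fix i assume "i < j"
  let ?h = "(next_move a m (star_claim X b v) ^^ i) h"
  have "touched ?h \<subseteq> touched ((next_move a m (star_claim X b v) ^^ k) h)"
    using \<open>i < j\<close> \<open>j \<le> Suc k\<close> by (intro touched_funpow_mono) simp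
  then have "v \<notin> touched ?h" using assms(1) by blast
  then show "next_move a m (star_breaker X b (v # \<sigma>)) ?h = next_move a m (star_claim X b v) ?h"
    by (simp add: next_move_def breaker_step_def star_breaker_def target_def)
qed

text \<open>
  Touched vertices never become targets again, so they can be deleted from the order.
\<close>

lemma forget_touched_targets:
  assumes "v \<in> touched h"
  shows "covers_from V a m (star_breaker X b (v # \<sigma>)) h
    \<longleftrightarrow> covers_from V a m (star_breaker X b (filter (\<lambda>v. v \<notin> touched h) \<sigma>)) h"
proof -
  let ?\<tau> = "filter (\<lambda>v. v \<notin> touched h) \<sigma>"
  have "(next_move a m (star_breaker X b (v # \<sigma>)) ^^ k) h = (next_move a m (star_breaker X b ?\<tau>) ^^ k) h" for k
  proof (rule funpow_cong_invariant)
    fix i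
    let ?h = "(next_move a m (star_breaker X b ?\<tau>) ^^ i) h"
    have "touched h \<subseteq> touched ?h" using touched_funpow_mono[of 0 i] by simp
    then have "filter (\<lambda>v. v \<notin> touched ?h) (v # \<sigma>) = filter (\<lambda>v. v \<notin> touched ?h) ?\<tau>"
      using assms by (auto intro!: filter_cong)
    then show "next_move a m (star_breaker X b (v # \<sigma>)) ?h = next_move a m (star_breaker X b ?\<tau>) ?h"
      by (simp only: next_move_def breaker_step_def star_breaker_def target_def)
  qed
  then show ?thesis by (simp add: covers_from_def)
qed

text \<open>
  This is what makes the chase for the next target start afresh: the relative order of the remaining
  vertices is uniform again.
\<close>

lemma filter_random_permutation:
  assumes "finite A"
  shows "map_pmf (filter P) (pmf_of_set (permutations_of_set A)) = pmf_of_set (permutations_of_set {x \<in> A. P x})"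
proof -
  have "filter P = fst \<circ> partition P" by (auto simp: o_def)
  then have "map_pmf (filter P) (pmf_of_set (permutations_of_set A))
      = map_pmf fst (map_pmf (partition P) (pmf_of_set (permutations_of_set A)))"
    by (simp only: pmf.map_comp)
  then show ?thesis
    by (simp only: partition_random_permutations[OF assms] map_fst_pair_pmf)
qed

lemma prob_bind_pmf:
  "measure_pmf.prob (bind_pmf M N) A = measure_pmf.expectation M (\<lambda>x. measure_pmf.prob (N x) A)"
  unfolding measure_pmf_bind
  by (subst measure_pmf.measure_bind[where N = "count_space UNIV"]) (auto simp: measure_pmf_in_subprob_algebra)

lemma prob_random_permutation_by_head:
  assumes "finite A" "A \<noteq> {}"
  shows "measure_pmf.prob (pmf_of_set (permutations_of_set A)) {\<sigma>. Q \<sigma>}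
    = (\<Sum>v\<in>A. measure_pmf.prob (pmf_of_set (permutations_of_set (A - {v}))) {\<sigma>. Q (v # \<sigma>)}) / real (card A)"
proof -
  have "pmf_of_set (permutations_of_set A)
      = pmf_of_set A \<bind> (\<lambda>v. map_pmf ((#) v) (pmf_of_set (permutations_of_set (A - {v}))))"
    using random_permutation_of_set[OF assms] by (simp add: map_pmf_def)
  then have "measure_pmf.prob (pmf_of_set (permutations_of_set A)) {\<sigma>. Q \<sigma>}
      = measure_pmf.expectation (pmf_of_set A)
          (\<lambda>v. measure_pmf.prob (map_pmf ((#) v) (pmf_of_set (permutations_of_set (A - {v})))) {\<sigma>. Q \<sigma>})"
    by (simp only: prob_bind_pmf)
  then show ?thesis
    using assms by (simp add: integral_pmf_of_set vimage_def)
qed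

text \<open>
  The only parameter of a position that matters is the number of untouched vertices. Asking for a
  bound at \<open>u\<close> \<^emph>\<open>or more\<close> of them makes the notion monotone in \<open>u\<close>.
\<close>

definition cover_bound :: "'v set set \<Rightarrow> 'v set \<Rightarrow> nat \<Rightarrow> nat \<Rightarrow> 'v set maker \<Rightarrow> nat \<Rightarrow> real \<Rightarrow> bool" where
  "cover_bound X V a b m u x \<longleftrightarrow> (\<forall>h. u \<le> card (V - touched h) \<longrightarrow>
     measure_pmf.prob (pmf_of_set (permutations_of_set (V - touched h)))
       {\<sigma>. covers_from V a m (star_breaker X b \<sigma>) h} \<le> x)"

lemma cover_boundD:
  assumes "cover_bound X V a b m u x" "u \<le> card (V - touched h)"
  shows "measure_pmf.prob (pmf_of_set (permutations_of_set (V - touched h)))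
       {\<sigma>. covers_from V a m (star_breaker X b \<sigma>) h} \<le> x"
  using assms unfolding cover_bound_def by blast

lemma cover_bound_one: "cover_bound X V a b m u 1"
  by (simp add: cover_bound_def)

lemma cover_bound_mono: "cover_bound X V a b m u x \<Longrightarrow> u \<le> u' \<Longrightarrow> x \<le> x' \<Longrightarrow> cover_bound X V a b m u' x'"
  unfolding cover_bound_def by (meson order_trans)

text \<open>
  The position \<open>h'\<close> at which the first target \<open>v\<close> falls depends on \<open>v\<close> but not on the rest of the
  order, so given \<open>v\<close>, the rest is still uniform when play continues from \<open>h'\<close>.
\<close>

lemma covered_through_first_target:
  assumes "finite X" "0 < b" "\<And>w. m w \<in> X" "v \<in> V - touched h"
    and rounds: "a * Suc (card (star X v) div b) \<le> T"
  obtains (lost) "\<And>\<sigma>. \<not> covers_from V a m (star_breaker X b (v # \<sigma>)) h"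
  | (hit) h' i where "i < T" "v \<in> ghost_attempt m h i"
     "touched h' = touched h \<union> (\<Union>j<Suc i. ghost_attempt m h j)"
     "\<And>\<sigma>. covers_from V a m (star_breaker X b (v # \<sigma>)) h \<Longrightarrow>
        covers_from V a m (star_breaker X b (filter (\<lambda>w. w \<notin> touched h') \<sigma>)) h'"
proof -
  let ?run = "\<lambda>k. (next_move a m (star_claim X b v) ^^ k) h"
  have "v \<notin> touched h" using assms by blast
  show ?thesis
  proof (rule chase_ends[OF assms(1,2) \<open>v \<notin> touched h\<close>, where a = a and m = m])
    fix k assume isolated: "v \<notin> touched (?run k)" "star X v \<subseteq> breaker_edges (?run k)"
    show ?thesis
    proof (rule lost, rule notI)
      fix \<sigma> assume "covers_from V a m (star_breaker X b (v # \<sigma>)) h"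
      from covers_from_later[OF this, where j = k]
      have covers: "covers_from V a m (star_breaker X b (v # \<sigma>)) (?run k)"
        unfolding head_is_chased[OF isolated(1) le_SucI[OF order_refl]] .
      have "v \<in> V" using assms(4) by blast
      then show False
        by (rule notE[OF isolated_never_covered[OF assms(3) _ isolated(2,1)] covers])
    qed
  next
    fix k i
    assume hit: "v \<notin> touched (?run k)" "v \<in> ghost_attempt m h i"
      "?run (Suc k) = Attempt (ghost_attempt m h i) # ?run k"
      "touched (?run k) = touched h \<union> (\<Union>j<i. ghost_attempt m h j)"
      "i < a * Suc (card (star X v) div b)"
    show ?thesis
    proof (rule that(2)[of i "?run (Suc k)"])
      show "touched (?run (Suc k)) = touched h \<union> (\<Union>j<Suc i. ghost_attempt m h j)"
        unfolding hit(3) touched.simps hit(4) lessThan_Suc by blast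
      have v: "v \<in> touched (?run (Suc k))"
        unfolding hit(3) touched.simps using hit(2) by blast
      fix \<sigma> assume "covers_from V a m (star_breaker X b (v # \<sigma>)) h"
      from covers_from_later[OF this, where j = "Suc k"]
      have "covers_from V a m (star_breaker X b (v # \<sigma>)) (?run (Suc k))"
        unfolding head_is_chased[OF hit(1) order_refl] .
      then show "covers_from V a m (star_breaker X b (filter (\<lambda>w. w \<notin> touched (?run (Suc k))) \<sigma>)) (?run (Suc k))"
        unfolding forget_touched_targets[OF v] .
    qed (use hit(2,5) rounds in auto)
  qed
qed

text \<open>
  A uniformly random order begins with a uniformly random vertex. Charge each first target that falls
  to the attempt of the ghost sequence that hits it: every attempt has two endpoints, so it is
  charged at most twice, and the first \<open>i\<close> attempts touch at most \<open>2 * i\<close> new vertices.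
\<close>

lemma cover_bound_step:
  assumes fin: "finite X" "finite V" and b: "0 < b" and attempts: "\<And>w. m w \<in> X"
    and edges: "\<And>e. e \<in> X \<Longrightarrow> card e = 2"
    and rounds: "\<And>v. v \<in> V \<Longrightarrow> a * Suc (card (star X v) div b) \<le> T"
    and later: "\<And>i. i < T \<Longrightarrow> cover_bound X V a b m (u - 2 * Suc i) (x i)"
    and nonneg: "\<And>i. i < T \<Longrightarrow> 0 \<le> x i" and "0 < u"
  shows "cover_bound X V a b m u (2 / real u * (\<Sum>i<T. x i))"
  unfolding cover_bound_def
proof (intro allI impI)
  fix h
  let ?U = "V - touched h"
  let ?P = "\<lambda>A Q. measure_pmf.prob (pmf_of_set (permutations_of_set A)) {\<sigma>. Q \<sigma>}"
  assume u: "u \<le> card ?U"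
  then have nonempty: "?U \<noteq> {}" using \<open>0 < u\<close> by force
  have ghost: "card (ghost_attempt m h i) = 2" for i
    using attempts edges by (simp add: ghost_attempt_def)
  have ghost_fin: "finite (ghost_attempt m h i)" for i
    using ghost[of i] card.infinite by fastforce
  have head: "?P (?U - {v}) (\<lambda>\<sigma>. covers_from V a m (star_breaker X b (v # \<sigma>)) h)
      \<le> (\<Sum>i<T. if v \<in> ghost_attempt m h i then x i else 0)" (is "_ \<le> ?S") if "v \<in> ?U" for v
  proof -
    have rounds_v: "a * Suc (card (star X v) div b) \<le> T" using that rounds by blast
    have nn: "\<And>i. i \<in> {..<T} \<Longrightarrow> 0 \<le> (if v \<in> ghost_attempt m h i then x i else 0)"
      using nonneg by simp
    show ?thesis
    proof (rule covered_through_first_target[OF fin(1) b attempts that rounds_v])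
      assume "\<And>\<sigma>. \<not> covers_from V a m (star_breaker X b (v # \<sigma>)) h"
      then show ?thesis using sum_nonneg[of "{..<T}", OF nn] by simp
    next
      fix h' i
      assume hit: "i < T" "v \<in> ghost_attempt m h i"
        "touched h' = touched h \<union> (\<Union>j<Suc i. ghost_attempt m h j)"
        "\<And>\<sigma>. covers_from V a m (star_breaker X b (v # \<sigma>)) h \<Longrightarrow>
          covers_from V a m (star_breaker X b (filter (\<lambda>w. w \<notin> touched h') \<sigma>)) h'"
      let ?U' = "V - touched h'"
      let ?new = "\<Union>j<Suc i. ghost_attempt m h j"
      have "card ?new \<le> (\<Sum>j<Suc i. card (ghost_attempt m h j))" by (rule card_UN_le) simp
      also have "\<dots> = 2 * Suc i" by (simp add: ghost)
      finally have "card ?new \<le> 2 * Suc i" .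
      moreover have "card ?U - card ?new \<le> card (?U - ?new)"
        using ghost_fin by (intro diff_card_le_card_Diff) auto
      moreover have "?U - ?new = ?U'" using hit(3) by blast
      ultimately have remaining: "u - 2 * Suc i \<le> card ?U'" using u by (metis diff_le_mono diff_le_mono2 order_trans)
      have "v \<in> touched h'" using hit(2,3) by auto
      then have "{w \<in> ?U - {v}. w \<notin> touched h'} = ?U'" using hit(3) by blast
      then have filtered: "map_pmf (filter (\<lambda>w. w \<notin> touched h')) (pmf_of_set (permutations_of_set (?U - {v})))
          = pmf_of_set (permutations_of_set ?U')"
        using filter_random_permutation[of "?U - {v}" "\<lambda>w. w \<notin> touched h'"] fin by simp
      have "?P (?U - {v}) (\<lambda>\<sigma>. covers_from V a m (star_breaker X b (v # \<sigma>)) h)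
          \<le> ?P (?U - {v}) (\<lambda>\<sigma>. covers_from V a m (star_breaker X b (filter (\<lambda>w. w \<notin> touched h') \<sigma>)) h')"
        using hit(4) by (intro measure_pmf.finite_measure_mono) auto
      also have "\<dots> = ?P ?U' (\<lambda>\<sigma>. covers_from V a m (star_breaker X b \<sigma>) h')"
        unfolding filtered[symmetric] by (simp add: vimage_def)
      also have "\<dots> \<le> x i"
        using cover_boundD[OF later[OF hit(1)] remaining] .
      also have "x i = (if v \<in> ghost_attempt m h i then x i else 0)" using hit(2) by simp
      also have "\<dots> \<le> ?S" using nn hit(1) by (intro member_le_sum) auto
      finally show ?thesis .
    qed
  qed
  have "(\<Sum>v\<in>?U. \<Sum>i<T. if v \<in> ghost_attempt m h i then x i else 0)
      = (\<Sum>i<T. \<Sum>v\<in>?U. if v \<in> ghost_attempt m h i then x i else 0)"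
    by (rule sum.swap)
  also have "\<dots> = (\<Sum>i<T. real (card (?U \<inter> ghost_attempt m h i)) * x i)"
    using fin by (intro sum.cong) (simp_all add: sum.If_cases Collect_mem_eq)
  also have "\<dots> \<le> (\<Sum>i<T. 2 * x i)"
  proof (intro sum_mono mult_right_mono)
    fix i
    have "card (?U \<inter> ghost_attempt m h i) \<le> card (ghost_attempt m h i)"
      using ghost_fin by (intro card_mono) auto
    then show "real (card (?U \<inter> ghost_attempt m h i)) \<le> 2" using ghost[of i] by simp
  qed (use nonneg in auto)
  finally have total: "(\<Sum>v\<in>?U. \<Sum>i<T. if v \<in> ghost_attempt m h i then x i else 0) \<le> 2 * (\<Sum>i<T. x i)"
    by (simp add: sum_distrib_left)
  have "?P ?U (\<lambda>\<sigma>. covers_from V a m (star_breaker X b \<sigma>) h)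
      = (\<Sum>v\<in>?U. ?P (?U - {v}) (\<lambda>\<sigma>. covers_from V a m (star_breaker X b (v # \<sigma>)) h)) / real (card ?U)"
    using fin nonempty by (intro prob_random_permutation_by_head) auto
  also have "\<dots> \<le> (2 * (\<Sum>i<T. x i)) / real (card ?U)"
    using order_trans[OF sum_mono[OF head] total] by (intro divide_right_mono) auto
  also have "\<dots> \<le> (2 * (\<Sum>i<T. x i)) / real u"
    using u \<open>0 < u\<close> nonneg by (intro divide_left_mono mult_nonneg_nonneg sum_nonneg mult_pos_pos) auto
  finally show "?P ?U (\<lambda>\<sigma>. covers_from V a m (star_breaker X b \<sigma>) h) \<le> 2 / real u * (\<Sum>i<T. x i)"
    by simp
qed

section \<open>Solving the recursion\<close>

text \<open>
  The bound for \<open>k\<close> successive targets, each of which costs \<open>d\<close> of the \<open>x\<close> untouched vertices.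
\<close>

definition restart_prod :: "nat \<Rightarrow> real \<Rightarrow> real \<Rightarrow> real" where
  "restart_prod k d x = (\<Prod>i<k. d / (x - real i * d))"

lemma restart_prod_Suc: "restart_prod (Suc k) d x = d / x * restart_prod k d (x - d)"
  unfolding restart_prod_def by (subst prod.lessThan_Suc_shift) (simp add: algebra_simps)

lemma restart_prod_scale: "r \<noteq> 0 \<Longrightarrow> restart_prod k (d / r) (x / r) = restart_prod k d x"
  unfolding restart_prod_def
  by (intro prod.cong) (simp_all flip: diff_divide_distrib)

lemma restart_prod_nonneg:
  assumes "0 \<le> d" "real k * d \<le> x + d"
  shows "0 \<le> restart_prod k d x"
  unfolding restart_prod_def
proof (intro prod_nonneg ballI divide_nonneg_nonneg)
  fix i assume "i \<in> {..<k}"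
  then have "real (Suc i) * d \<le> real k * d" using assms(1) by (intro mult_right_mono) auto
  then show "0 \<le> x - real i * d" using assms(2) by (simp add: algebra_simps)
qed (use assms in auto)

lemma tendsto_restart_prod:
  assumes "(f \<longlongrightarrow> d) F" "(g \<longlongrightarrow> x) F" "0 < d" "real k * d < x + d"
  shows "((\<lambda>n. restart_prod k (f n) (g n)) \<longlongrightarrow> restart_prod k d x) F"
  unfolding restart_prod_def
proof (intro tendsto_prod tendsto_divide tendsto_diff tendsto_mult tendsto_const assms)
  fix i assume "i \<in> {..<k}"
  then have "real (Suc i) * d \<le> real k * d" using \<open>0 < d\<close> by (intro mult_right_mono) auto
  then show "x - real i * d \<noteq> 0" using assms(4) by (simp add: algebra_simps)
qed

text \<open>
  The property of \<open>cover_bound\<close> that remains when the game is forgotten; \<open>B u x\<close> reads: \<open>x\<close> bounds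
  Maker's chances when at least \<open>u\<close> vertices are untouched.
\<close>

locale touching_recursion =
  fixes B :: "nat \<Rightarrow> real \<Rightarrow> bool" and T :: nat
  assumes one: "B u 1"
    and mono: "B u x \<Longrightarrow> u \<le> u' \<Longrightarrow> B u' x"
    and step: "0 < u \<Longrightarrow> (\<And>i. i < T \<Longrightarrow> B (u - 2 * Suc i) (y i)) \<Longrightarrow> (\<And>i. i < T \<Longrightarrow> 0 \<le> y i)
      \<Longrightarrow> B u (2 / real u * (\<Sum>i<T. y i))"
begin

text \<open>
  The crude solution of the recursion, which treats every target as falling as late as possible.
\<close>

lemma bound_restart_prod:
  assumes "k * (2 * T) < u + 2 * T"
  shows "B u (restart_prod k (2 * real T) (real u))"
  using assms
proof (induction k arbitrary: u)
  case 0
  show ?case by (simp add: restart_prod_def one)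
next
  case (Suc k)
  have u: "k * (2 * T) < u" using Suc.prems by simp
  show ?case
  proof (cases k)
    case 0
    then show ?thesis using step[of u "\<lambda>_. 1"] u one by (simp add: restart_prod_def)
  next
    case (Suc l)
    then have D: "2 * T \<le> u" using u by simp
    let ?x = "restart_prod k (2 * real T) (real u - 2 * real T)"
    have tail: "B (u - 2 * T) ?x"
      using Suc.IH[of "u - 2 * T"] u D by (simp add: of_nat_diff)
    have "real (k * (2 * T)) \<le> real u"
      using u by (simp only: of_nat_le_iff)
    then have nonneg: "0 \<le> ?x"
      by (intro restart_prod_nonneg) auto
    have "B u (2 / real u * (\<Sum>i<T. ?x))"
      using u nonneg by (intro step mono[OF tail]) auto
    then show ?thesis
      by (simp add: restart_prod_Suc mult_ac)
  qed
qed

text \<open>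
  The refined solution: a target that falls within the first \<open>S\<close> attempts leaves at least \<open>u - 2 * S\<close>
  vertices, which is enough for \<open>k + 1\<close> further factors instead of \<open>k\<close>.
\<close>

lemma bound_two_speeds:
  assumes S: "S \<le> T" and T: "2 * T \<le> u" "0 < u"
    and room: "k * (2 * T) + 2 * S < u"
  shows "B u (2 * real S / real u * restart_prod (Suc k) (2 * real T) (real u - 2 * real S)
    + (2 * real T - 2 * real S) / real u * restart_prod k (2 * real T) (real u - 2 * real T))"
proof -
  let ?q = "restart_prod (Suc k) (2 * real T) (real u - 2 * real S)"
  let ?Q = "restart_prod k (2 * real T) (real u - 2 * real T)"
  let ?x = "\<lambda>i. if i < S then ?q else ?Q"
  have "B u (2 / real u * (\<Sum>i<T. ?x i))"
  proof (rule step)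
    fix i assume "i < T"
    have q: "B (u - 2 * S) ?q"
      using bound_restart_prod[of "Suc k" "u - 2 * S"] room S T by (simp add: of_nat_diff)
    have Q: "B (u - 2 * T) ?Q"
      using bound_restart_prod[of k "u - 2 * T"] room T by (simp add: of_nat_diff)
    show "B (u - 2 * Suc i) (?x i)"
      using mono[OF q, of "u - 2 * Suc i"] mono[OF Q, of "u - 2 * Suc i"] \<open>i < T\<close> by simp
    have "real (k * (2 * T) + 2 * S) \<le> real u"
      using room by (simp only: of_nat_le_iff)
    then have real_room: "real k * (2 * real T) + 2 * real S \<le> real u" by simp
    have "0 \<le> ?q"
      using real_room by (intro restart_prod_nonneg) (simp_all add: distrib_right)
    moreover have "0 \<le> ?Q"
      using real_room by (intro restart_prod_nonneg) simp_all
    ultimately show "0 \<le> ?x i" by simp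
  qed (use T in simp)
  also have "(\<Sum>i<T. ?x i) = real S * ?q + (real T - real S) * ?Q"
  proof -
    have "{..<T} \<inter> {i. i < S} = {..<S}" "{..<T} \<inter> - {i. i < S} = {S..<T}" using S by auto
    then show ?thesis using S by (simp add: sum.If_cases of_nat_diff)
  qed
  also have "2 / real u * (real S * ?q + (real T - real S) * ?Q)
      = 2 * real S / real u * ?q + (2 * real T - 2 * real S) / real u * ?Q"
    using T(2) by (simp add: field_simps)
  finally show ?thesis .
qed

end

text \<open>
  With \<open>\<eta> = 0\<close> both sides agree, but the factor \<open>restart_prod (Suc k) d 1\<close> belonging to \<open>\<eta>\<close> is then
  \<open>d < 1\<close> times the factor \<open>restart_prod k d (1 - d)\<close> that it replaces. By continuity it is still
  smaller for some \<open>\<eta> > 0\<close>.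
\<close>

lemma early_touches_gain:
  assumes "0 < d" "d < 1" "real (Suc k) * d \<le> 1"
  obtains \<eta> where "0 < \<eta>" "\<eta> < d"
    "\<eta> * restart_prod (Suc k) d (1 - \<eta>) + (d - \<eta>) * restart_prod k d (1 - d) < restart_prod (Suc k) d 1"
proof -
  let ?Q = "restart_prod k d (1 - d)"
  have pos: "0 < ?Q"
    unfolding restart_prod_def
  proof (intro prod_pos ballI divide_pos_pos)
    fix i assume "i \<in> {..<k}"
    then have "real (i + 2) * d \<le> real (Suc k) * d" using \<open>0 < d\<close> by (intro mult_right_mono) auto
    then show "0 < 1 - d - real i * d" using assms by (simp add: algebra_simps)
  qed (use assms in auto)
  have at0: "restart_prod (Suc k) d 1 = d * ?Q" by (simp add: restart_prod_Suc)
  have "((\<lambda>\<eta>. restart_prod (Suc k) d (1 - \<eta>)) \<longlongrightarrow> restart_prod (Suc k) d (1 - 0)) (at_right 0)"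
    using assms by (intro tendsto_restart_prod tendsto_intros) auto
  then have "\<forall>\<^sub>F \<eta> in at_right 0. restart_prod (Suc k) d (1 - \<eta>) < ?Q"
  proof (rule order_tendstoD(2))
    show "restart_prod (Suc k) d (1 - 0) < ?Q" using pos \<open>d < 1\<close> at0 by simp
  qed
  moreover have "\<forall>\<^sub>F \<eta> in at_right 0. \<eta> \<in> {0<..<d}"
    using \<open>0 < d\<close> by (rule eventually_at_right_real)
  ultimately have "\<forall>\<^sub>F \<eta> in at_right 0. restart_prod (Suc k) d (1 - \<eta>) < ?Q \<and> \<eta> \<in> {0<..<d}"
    by (rule eventually_conj)
  then obtain \<eta> where \<eta>: "restart_prod (Suc k) d (1 - \<eta>) < ?Q" "0 < \<eta>" "\<eta> < d"
    using eventually_happens'[of "at_right (0::real)"] by auto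
  then have "\<eta> * restart_prod (Suc k) d (1 - \<eta>) < \<eta> * ?Q" by simp
  then show ?thesis using \<eta> that at0 by (simp add: algebra_simps)
qed

text \<open>
  Dividing everything by \<open>n\<close> turns \<open>bound_two_speeds\<close> into an expression that converges to the left
  side of \<open>early_touches_gain\<close>, so from some \<open>n\<close> on it is below the target value.
\<close>

lemma eventually_bound:
  fixes T :: "nat \<Rightarrow> nat"
  assumes "0 < d" "d < 1" "real (Suc k) * d \<le> 1" and lim: "(\<lambda>n. 2 * real (T n) / real n) \<longlonglongrightarrow> d"
  shows "\<forall>\<^sub>F n in sequentially. \<forall>B. touching_recursion B (T n) \<longrightarrow> (\<exists>x \<le> restart_prod (Suc k) d 1. B n x)"
proof -
  obtain \<eta> where \<eta>: "0 < \<eta>" "\<eta> < d"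
    "\<eta> * restart_prod (Suc k) d (1 - \<eta>) + (d - \<eta>) * restart_prod k d (1 - d) < restart_prod (Suc k) d 1"
    using early_touches_gain[OF assms(1-3)] by blast
  \<comment> \<open>\<open>S n\<close> attempts touch about \<open>\<eta> n\<close> vertices, whence the factor \<open>1 / 2\<close>.\<close>
  define S where "S n = nat \<lfloor>\<eta> / 2 * real n\<rfloor>" for n
  define D where "D n = 2 * real (T n) / real n" for n
  define E where "E n = 2 * real (S n) / real n" for n
  have D: "D \<longlonglongrightarrow> d" using lim by (simp add: D_def[abs_def])
  have E: "E \<longlonglongrightarrow> \<eta>"
  proof (rule tendsto_sandwich)
    show "\<forall>\<^sub>F n in sequentially. \<eta> - 2 / real n \<le> E n"
      using eventually_gt_at_top[of 0]
    proof eventually_elim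
      case (elim n)
      have "\<eta> / 2 * real n - 1 \<le> real (S n)" unfolding S_def by linarith
      then have "(\<eta> * real n - 2) / real n \<le> E n"
        unfolding E_def by (intro divide_right_mono) auto
      then show ?case using elim by (simp add: diff_divide_distrib)
    qed
    show "\<forall>\<^sub>F n in sequentially. E n \<le> \<eta>"
      using eventually_gt_at_top[of 0]
    proof eventually_elim
      case (elim n)
      have "0 \<le> \<eta> / 2 * real n" using \<eta>(1) by simp
      then have "real (S n) \<le> \<eta> / 2 * real n" unfolding S_def by linarith
      then show ?case using elim by (simp add: E_def field_simps)
    qed
    show "(\<lambda>n. \<eta> - 2 / real n) \<longlonglongrightarrow> \<eta>"
      using tendsto_diff[OF tendsto_const lim_const_over_n, of \<eta> 2] by simp
  qed simp
  have k: "real k * d < 1" using assms by (simp add: algebra_simps)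
  have "(\<lambda>n. E n * restart_prod (Suc k) (D n) (1 - E n) + (D n - E n) * restart_prod k (D n) (1 - D n))
      \<longlonglongrightarrow> \<eta> * restart_prod (Suc k) d (1 - \<eta>) + (d - \<eta>) * restart_prod k d (1 - d)"
    using \<eta> assms k by (intro tendsto_intros tendsto_restart_prod D E) (auto simp: algebra_simps)
  then have ev1: "\<forall>\<^sub>F n in sequentially.
     E n * restart_prod (Suc k) (D n) (1 - E n) + (D n - E n) * restart_prod k (D n) (1 - D n) < restart_prod (Suc k) d 1"
    using \<eta>(3) by (rule order_tendstoD(2))
  have "(\<lambda>n. D n - E n) \<longlonglongrightarrow> d - \<eta>" by (intro tendsto_intros D E)
  then have ev2: "\<forall>\<^sub>F n in sequentially. 0 < D n - E n"
    by (rule order_tendstoD(1)) (use \<eta> in simp)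
  have ev3: "\<forall>\<^sub>F n in sequentially. D n < 1" using D \<open>d < 1\<close> by (rule order_tendstoD(2))
  have "(\<lambda>n. real k * D n + E n) \<longlonglongrightarrow> real k * d + \<eta>" by (intro tendsto_intros D E)
  then have ev4: "\<forall>\<^sub>F n in sequentially. real k * D n + E n < 1"
    by (rule order_tendstoD(2)) (use \<eta> assms in \<open>simp add: algebra_simps\<close>)
  show ?thesis
    using ev1 ev2 ev3 ev4 eventually_gt_at_top[of 0]
  proof eventually_elim
    case (elim n)
    note n = elim(5)
    show ?case
    proof (intro allI impI)
      fix B assume "touching_recursion B (T n)"
      then interpret touching_recursion B "T n" .
      have "E n < D n" using elim(2) by simp
      then have "real (S n) < real (T n)" using n by (simp add: D_def E_def divide_less_cancel)
      then have S: "S n \<le> T n" by simp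
      have "2 * real (T n) < real n" using elim(3) n by (simp add: D_def)
      then have T: "2 * T n \<le> n" by linarith
      have "(real k * (2 * real (T n)) + 2 * real (S n)) / real n < 1"
        using elim(4) by (simp add: D_def E_def add_divide_distrib)
      then have "real k * (2 * real (T n)) + 2 * real (S n) < real n"
        using n by simp
      then have "real (k * (2 * T n) + 2 * S n) < real n" by simp
      then have room: "k * (2 * T n) + 2 * S n < n" by (simp only: of_nat_less_iff)
      have scale: "restart_prod j (2 * real (T n)) (real n - x) = restart_prod j (D n) (1 - x / real n)" for j x
        using n restart_prod_scale[of "real n" j "2 * real (T n)" "real n - x"]
        by (simp add: D_def diff_divide_distrib)
      have "B n (E n * restart_prod (Suc k) (D n) (1 - E n) + (D n - E n) * restart_prod k (D n) (1 - D n))"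
        using bound_two_speeds[OF S T n room] unfolding scale
        by (simp only: D_def E_def diff_divide_distrib)
      then show "\<exists>x \<le> restart_prod (Suc k) d 1. B n x"
        using elim(1) less_imp_le by blast
    qed
  qed
qed

text \<open>
  A star has \<open>n - 1\<close> edges, so \<open>a * Suc ((n - 1) div b)\<close> is the number of attempts in which a target
  has to be touched.
\<close>

lemma rounds_asymptotics:
  fixes a b :: nat
  assumes "0 < b"
  shows "(\<lambda>n. 2 * real (a * Suc ((n - 1) div b)) / real n) \<longlonglongrightarrow> 2 * real a / real b"
proof -
  have *: "(\<lambda>n. real (Suc ((n - 1) div b)) / real n) \<longlonglongrightarrow> 1 / real b"
  proof (rule tendsto_sandwich)
    show "\<forall>\<^sub>F n in sequentially. 1 / real b - 1 / real n \<le> real (Suc ((n - 1) div b)) / real n"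
      using eventually_gt_at_top[of 0]
    proof eventually_elim
      case (elim n)
      have "n - 1 < b * Suc ((n - 1) div b)" using assms by (simp add: dividend_less_times_div)
      then have "n \<le> b * Suc ((n - 1) div b)" using elim by linarith
      then have "real n \<le> real b * real (Suc ((n - 1) div b))" by (simp only: of_nat_le_iff flip: of_nat_mult)
      then have "real n / real b \<le> real (Suc ((n - 1) div b))" using assms by (simp add: field_simps)
      then have "1 / real b \<le> real (Suc ((n - 1) div b)) / real n" using elim assms by (simp add: field_simps)
      then show ?case using elim by (smt (verit) divide_nonneg_nonneg of_nat_0_le_iff)
    qed
    show "\<forall>\<^sub>F n in sequentially. real (Suc ((n - 1) div b)) / real n \<le> 1 / real b + 1 / real n"
      using eventually_gt_at_top[of 0]
    proof eventually_elim
      case (elim n)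
      have "real ((n - 1) div b) \<le> real (n - 1) / real b" by (rule of_nat_div_le_of_nat)
      also have "\<dots> \<le> real n / real b" by (intro divide_right_mono) auto
      finally have "real (Suc ((n - 1) div b)) \<le> real n / real b + 1" by simp
      then have "real (Suc ((n - 1) div b)) / real n \<le> (real n / real b + 1) / real n" by (intro divide_right_mono) auto
      also have "\<dots> = 1 / real b + 1 / real n" using elim by (simp add: field_simps)
      finally show ?case .
    qed
    show "(\<lambda>n. 1 / real b - 1 / real n) \<longlonglongrightarrow> 1 / real b"
      using tendsto_diff[OF tendsto_const lim_const_over_n, of "1 / real b" 1] by simp
    show "(\<lambda>n. 1 / real b + 1 / real n) \<longlonglongrightarrow> 1 / real b"
      using tendsto_add[OF tendsto_const lim_const_over_n, of "1 / real b" 1] by simp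
  qed
  have "(\<lambda>n. 2 * real a * (real (Suc ((n - 1) div b)) / real n)) \<longlonglongrightarrow> 2 * real a * (1 / real b)"
    by (intro tendsto_mult tendsto_const *)
  then show ?thesis
    by (simp only: of_nat_mult times_divide_eq_right mult.assoc mult_1_right)
qed

section \<open>The minimum-degree game\<close>

lemma complete_edges_finite: "finite (complete_edges n)"
  by (rule finite_subset[of _ "Pow {..<n}"]) (auto simp: complete_edges_def)

lemma card_star_complete_edges:
  assumes "v < n"
  shows "card (star (complete_edges n) v) \<le> n - 1"
proof -
  have "star (complete_edges n) v \<subseteq> (\<lambda>w. {v, w}) ` ({..<n} - {v})"
    by (auto simp: star_def complete_edges_def card_2_iff)
  then have "card (star (complete_edges n) v) \<le> card ({..<n} - {v})"
    by (meson card_image_le card_mono finite_Diff finite_imageI finite_lessThan order_trans)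
  then show ?thesis using assms by simp
qed

lemma maker_wins_covers:
  assumes "0 < n" "maker_wins (mindegree_sets n 1) a m p"
  shows "covers_from {..<n} a m p []"
proof -
  obtain r W where W: "W \<in> mindegree_sets n 1" and sub: "W \<subseteq> maker_edges (play a m p r)"
    using assms(2) unfolding maker_wins_def by blast
  have "covers {..<n} (play a m p r)"
    unfolding covers_def
  proof
    fix v assume v: "v \<in> {..<n}"
    have "Min (degree_in W ` {..<n}) \<le> degree_in W v"
      using v by (intro Min_le) auto
    then have "card {e \<in> W. v \<in> e} \<noteq> 0"
      using W by (simp add: mindegree_sets_def min_degree_def degree_in_def)
    then have "{e \<in> W. v \<in> e} \<noteq> {}" by (metis card.empty)
    then show "\<exists>e\<in>maker_edges (play a m p r). v \<in> e" using sub by blast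
  qed
  then show ?thesis
    using play_eq_next_moves[of a m p r] unfolding covers_from_def by metis
qed

text \<open>
  Maker's randomness does not help her: the bound holds for each of her deterministic strategies.
\<close>

lemma prob_pair_pmf_le:
  assumes "\<And>x. x \<in> set_pmf M \<Longrightarrow> measure_pmf.prob P {y. Q x y} \<le> c"
  shows "measure_pmf.prob (pair_pmf M P) {(x, y). Q x y} \<le> c"
proof -
  have "measure_pmf.prob (pair_pmf M P) {(x, y). Q x y}
      = measure_pmf.expectation M (\<lambda>x. measure_pmf.prob (map_pmf (Pair x) P) {(x, y). Q x y})"
    unfolding pair_pmf_def map_pmf_def by (rule prob_bind_pmf)
  also have "\<dots> \<le> c"
    using assms by (intro measure_pmf.integral_le_const measure_pmf.integrable_const_bound[where B = 1])
      (auto simp: AE_measure_pmf_iff vimage_def)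
  finally show ?thesis .
qed

lemma cover_bound_recursion:
  assumes "0 < b" and "0 < n" and "\<And>v. m v \<in> complete_edges n"
  shows "touching_recursion (cover_bound (complete_edges n) {..<n} a b m) (a * Suc ((n - 1) div b))"
proof
  fix u y
  assume "0 < u" and "\<And>i. i < a * Suc ((n - 1) div b) \<Longrightarrow> cover_bound (complete_edges n) {..<n} a b m (u - 2 * Suc i) (y i)"
    and "\<And>i. i < a * Suc ((n - 1) div b) \<Longrightarrow> 0 \<le> y i"
  moreover have "a * Suc (card (star (complete_edges n) v) div b) \<le> a * Suc ((n - 1) div b)" if "v \<in> {..<n}" for v
    using card_star_complete_edges[of v n] that by (intro mult_le_mono order_refl Suc_le_mono[THEN iffD2] div_le_mono) simp
  ultimately show "cover_bound (complete_edges n) {..<n} a b m u (2 / real u * (\<Sum>i<a * Suc ((n - 1) div b). y i))"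
    using assms by (intro cover_bound_step complete_edges_finite) (auto simp: complete_edges_def)
qed (auto intro: cover_bound_one cover_bound_mono)

theorem theorem1:
  fixes a b :: nat
  assumes "0 < a" and "0 < b" and "b > 2 * a"
  shows "\<exists>n0. \<forall>n\<ge>n0. \<exists>P. randomized_breaker (complete_edges n) b P \<and>
    (\<forall>M. randomized_maker (complete_edges n) M \<longrightarrow>
      maker_win_prob (mindegree_sets n 1) a M P
        \<le> (\<Prod>i<nat \<lfloor>real b / (2 * real a)\<rfloor>. 1 / (real b / (2 * real a) - real i)))"
proof -
  let ?c = "real b / (2 * real a)"
  let ?d = "2 * real a / real b"
  let ?p = "\<Prod>i<nat \<lfloor>?c\<rfloor>. 1 / (?c - real i)"
  have c: "1 < ?c" using assms by simp
  then obtain k where k: "nat \<lfloor>?c\<rfloor> = Suc k"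
    by (metis Suc_pred less_imp_le zero_less_nat_eq zero_less_floor)
  have d: "0 < ?d" "?d < 1" using assms by simp_all
  have "real (nat \<lfloor>?c\<rfloor>) \<le> ?c" using c by linarith
  then have "real (Suc k) \<le> ?c" unfolding k .
  then have kd: "real (Suc k) * ?d \<le> 1" using assms by (simp add: field_simps)
  have p: "restart_prod (Suc k) ?d 1 = ?p"
    unfolding k restart_prod_def using assms by (intro prod.cong) (simp_all add: field_simps)
  have "\<forall>\<^sub>F n in sequentially. \<forall>B. touching_recursion B (a * Suc ((n - 1) div b)) \<longrightarrow> (\<exists>x \<le> ?p. B n x)"
    using eventually_bound[OF d kd rounds_asymptotics[OF \<open>0 < b\<close>, of a]] unfolding p .
  then have "\<forall>\<^sub>F n in sequentially. 0 < n \<and>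
      (\<forall>B. touching_recursion B (a * Suc ((n - 1) div b)) \<longrightarrow> (\<exists>x \<le> ?p. B n x))"
    by (intro eventually_conj eventually_gt_at_top)
  then obtain n0 where n0: "\<forall>n\<ge>n0. 0 < n \<and>
      (\<forall>B. touching_recursion B (a * Suc ((n - 1) div b)) \<longrightarrow> (\<exists>x \<le> ?p. B n x))"
    unfolding eventually_sequentially ..
  show ?thesis
  proof (intro exI[of _ n0] allI impI)
    fix n assume "n0 \<le> n"
    note n0 = n0[rule_format, OF this]
    have n: "0 < n" using n0 by (rule conjunct1)
    let ?X = "complete_edges n" and ?V = "{..<n}"
    let ?P = "map_pmf (star_breaker ?X b) (pmf_of_set (permutations_of_set ?V))"
    have "randomized_breaker ?X b ?P"
      by (auto simp: randomized_breaker_def complete_edges_finite star_breaker_strategy)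
    moreover have "maker_win_prob (mindegree_sets n 1) a M ?P \<le> ?p" if M: "randomized_maker ?X M" for M
      unfolding maker_win_prob_def
    proof (rule prob_pair_pmf_le)
      fix m assume "m \<in> set_pmf M"
      then have m: "\<And>v. m v \<in> ?X" using M by (simp add: randomized_maker_def maker_strategy_def)
      have recursion: "touching_recursion (cover_bound ?X ?V a b m) (a * Suc ((n - 1) div b))"
        by (rule cover_bound_recursion[OF \<open>0 < b\<close> n]) (rule m)
      obtain x where x: "x \<le> ?p" "cover_bound ?X ?V a b m n x"
        using conjunct2[OF n0, rule_format, OF recursion] by (elim exE conjE)
      have "measure_pmf.prob ?P {p. maker_wins (mindegree_sets n 1) a m p}
          \<le> measure_pmf.prob ?P {p. covers_from ?V a m p []}"
        by (intro measure_pmf.finite_measure_mono Collect_mono impI maker_wins_covers[OF n]) simp_all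
      also have "\<dots> \<le> x"
        using cover_boundD[OF x(2), of "[]"] by (simp add: vimage_def)
      finally show "measure_pmf.prob ?P {p. maker_wins (mindegree_sets n 1) a m p} \<le> ?p"
        using x(1) by simp
    qed
    ultimately show "\<exists>P. randomized_breaker ?X b P \<and> (\<forall>M. randomized_maker ?X M \<longrightarrow>
        maker_win_prob (mindegree_sets n 1) a M P \<le> ?p)"
      by (intro exI[of _ ?P] conjI allI impI)
  qed
qed

end
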